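(* Let $\Sigma=\{\sigma_1,\ldots,\sigma_n\}$ be a collection of maps $\{1,\ldots,N\}\to\{1,\ldots,N\}$, not necessarily forming a semigroup, and let $P=\{P_1,\ldots,P_r\}$ be a partition of $\{1,\ldots,N\}$. Then $\mathrm{Syn}_P$ is a (robust) synchrony space for $\Sigma$ if and only if it is a (robust) synchrony space for the semigroup $\Sigma'$ generated by $\Sigma$.
   Context: $V$ is a finite dimensional real vector space, and the $\sigma_j$ are distinct. For a collection $\Sigma=\{\sigma_1,\ldots,\sigma_n\}$ of $n$ distinct maps on $\{1,\ldots,N\}$ and $f\in C^\infty(V^n,V)$, the network map/vector field $\gamma_f:V^N\to V^N$ subject to $\Sigma$ is $(\gamma_f)_i(x)=f(x_{\sigma_1(i)},\ldots,x_{\sigma_n(i)})$, $1\le i\le N$. The semigroup $\Sigma'=\{\sigma_1,\ldots,\sigma_n,\sigma_{n+1},\ldots,\sigma_{n'}\}$ generated by $\Sigma$ is the smallest collection of maps $\{1,\ldots,N\}\to\{1,\ldots,N\}$ that contains $\Sigma$ and is closed under composition; network maps subject to $\Sigma'$ are defined in the same way with $f\in C^\infty(V^{n'},V)$. For a partition $P$ of $\{1,\ldots,N\}$, $$\mathrm{Syn}_P:=\{x\in V^N\mid x_{i_1}=x_{i_2}\text{ when } i_1 \text{ and } i_2 \text{ are in the same element of } P\}.$$ $\mathrm{Syn}_P$ is called a (robust) synchrony space for $\Sigma$ if for every $f\in C^\infty(V^n,V)$ it is invariant for the dynamics of $\gamma_f$ (i.e. invariant under the map $\gamma_f$, equivalently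 $\gamma_f$ is tangent to $\mathrm{Syn}_P$ as a vector field), and analogously for $\Sigma'$ with all $f\in C^\infty(V^{n'},V)$. *)

theory Defs
  imports "HOL-Analysis.Analysis"
begin

text \<open>A point of \<open>V\<^sup>m\<close>, with \<open>V\<close> the carrier of the type \<open>'v\<close>, is an extensional function on
  \<open>{1..m}\<close>. The topology that this set inherits from \<open>nat \<Rightarrow> 'v\<close> is the product topology.\<close>

definition tuples :: "nat \<Rightarrow> (nat \<Rightarrow> 'v) set" where
  "tuples m = {1..m} \<rightarrow>\<^sub>E UNIV"

text \<open>\<open>C_k n k f\<close>: all partial derivatives of \<open>f : V\<^sup>n \<rightarrow> V\<close> of order at most \<open>k\<close> exist and are
  continuous. The partial derivative in the \<open>j\<close>-th argument is the Frechet derivative of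
  \<open>y \<mapsto> f (x\<^sub>1, \<dots>, x\<^sub>j\<^sub>-\<^sub>1, y, x\<^sub>j\<^sub>+\<^sub>1, \<dots>, x\<^sub>n)\<close> at \<open>x\<^sub>j\<close>, evaluated at a vector \<open>v\<close>.
  This is the usual class \<open>C\<^sup>k\<close> when \<open>V\<close> is finite dimensional, and it then does not depend on
  the norm of \<open>'v\<close>. Only the values of \<open>f\<close> on \<open>tuples n\<close> matter.\<close>

primrec C_k :: "nat \<Rightarrow> nat \<Rightarrow> ((nat \<Rightarrow> 'v::real_normed_vector) \<Rightarrow> 'v) \<Rightarrow> bool" where
  "C_k n 0 f \<longleftrightarrow> continuous_on (tuples n) f"
| "C_k n (Suc k) f \<longleftrightarrow>
     continuous_on (tuples n) f \<and>
     (\<forall>j\<in>{1..n}.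
        (\<forall>x\<in>tuples n. (\<lambda>y. f (x(j := y))) differentiable (at (x j))) \<and>
        (\<forall>v. C_k n k (\<lambda>x. frechet_derivative (\<lambda>y. f (x(j := y))) (at (x j)) v)))"

definition C_infinity :: "nat \<Rightarrow> ((nat \<Rightarrow> 'v::real_normed_vector) \<Rightarrow> 'v) \<Rightarrow> bool" where
  "C_infinity n f \<longleftrightarrow> (\<forall>k. C_k n k f)"

definition network_map ::
  "nat \<Rightarrow> nat \<Rightarrow> (nat \<Rightarrow> nat \<Rightarrow> nat) \<Rightarrow> ((nat \<Rightarrow> 'v) \<Rightarrow> 'v) \<Rightarrow> (nat \<Rightarrow> 'v) \<Rightarrow> (nat \<Rightarrow> 'v)" where
  "network_map N n \<sigma> f x = (\<lambda>i\<in>{1..N}. f (\<lambda>j\<in>{1..n}. x (\<sigma> j i)))"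

text \<open>Self-maps of \<open>{1..N}\<close> are elements of \<open>{1..N} \<rightarrow>\<^sub>E {1..N}\<close>, so that equality of functions is
  equality of maps; accordingly they are composed with \<^const>\<open>compose\<close>.\<close>

definition generated_semigroup :: "nat \<Rightarrow> (nat \<Rightarrow> nat) set \<Rightarrow> (nat \<Rightarrow> nat) set" where
  "generated_semigroup N \<Sigma> = (\<lambda>S. \<forall>g\<in>S. \<forall>h\<in>S. compose {1..N} g h \<in> S) hull \<Sigma>"

definition Syn :: "nat \<Rightarrow> nat set set \<Rightarrow> (nat \<Rightarrow> 'v) set" where
  "Syn N P = {x \<in> tuples N. \<forall>p\<in>P. \<forall>i\<^sub>1\<in>p. \<forall>i\<^sub>2\<in>p. x i\<^sub>1 = x i\<^sub>2}"

definition robust_synchrony_space ::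
  "nat \<Rightarrow> nat \<Rightarrow> (nat \<Rightarrow> nat \<Rightarrow> nat) \<Rightarrow> (nat \<Rightarrow> 'v::real_normed_vector) set \<Rightarrow> bool" where
  "robust_synchrony_space N n \<sigma> S \<longleftrightarrow>
     (\<forall>f. C_infinity n f \<longrightarrow> network_map N n \<sigma> f ` S \<subseteq> S)"

end

theory Submission
  imports Defs
begin

text \<open>Write \<^term>\<open>compose {1..N} x g\<close> for the pullback of a point \<open>x \<in> V\<^sup>N\<close> along a self-map
  \<open>g\<close> of \<open>{1..N}\<close>. Whether \<open>Syn N P\<close> is robust depends only on the individual maps \<open>\<sigma> j\<close>, and not
  on how a response function \<open>f\<close> combines them: it is robust exactly when pulling back along each
  \<open>\<sigma> j\<close> preserves it (\<open>robust_synchrony_space_iff_pullback\<close>). Necessity comes from the smooth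
  choice \<open>f x = x j\<close>, for which the network map is the pullback along \<open>\<sigma> j\<close>. For sufficiency, at a
  point of \<open>Syn N P\<close> two nodes in the same class have identical input tuples, hence identical
  values under any \<open>f\<close>.

  Pullback is contravariantly functorial, so the self-maps whose pullback preserves a given set form
  a semigroup (\<open>pullback_generated_semigroup\<close>). Such a semigroup contains \<open>\<Sigma>\<close> if and only if it
  contains the semigroup generated by \<open>\<Sigma>\<close>, which is the claim. Working with pullbacks, rather than
  with the condition that the \<open>\<sigma> j\<close> map classes of \<open>P\<close> into classes of \<open>P\<close>, makes the argument
  uniform in \<open>V\<close>: for \<open>V = 0\<close> robustness does not imply the condition on classes.\<close>

lemma C_k_const: "C_k n k (\<lambda>_. c)"
  by (induction k arbitrary: c) auto

text \<open>The partial derivatives of a coordinate projection are constant: they are the identity in the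
  projected argument and zero in all others.\<close>

lemma C_infinity_coordinate: "C_infinity n (\<lambda>x :: nat \<Rightarrow> 'v::real_normed_vector. x j)"
proof -
  have cont: "continuous_on (tuples n) (\<lambda>x :: nat \<Rightarrow> 'v. x j)"
    by (rule continuous_on_subset[OF continuous_on_product_coordinates]) simp
  have upd: "(\<lambda>y :: 'v. (x(i := y)) j) = (if i = j then (\<lambda>y. y) else (\<lambda>_. x j))" for x i
    by auto
  have "C_k n k (\<lambda>x :: nat \<Rightarrow> 'v. x j)" for k
  proof (cases k)
    case 0
    then show ?thesis
      by (simp add: cont)
  next
    case (Suc m)
    have "C_k n m (\<lambda>x :: nat \<Rightarrow> 'v. frechet_derivative (\<lambda>y. (x(i := y)) j) (at (x i)) v)" for i v
      unfolding upd by (cases "i = j") (simp_all add: C_k_const)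
    moreover have "(\<lambda>y :: 'v. (x(i := y)) j) differentiable at (x i)" for x i
      unfolding upd by simp
    ultimately show ?thesis
      unfolding Suc C_k.simps using cont by blast
  qed
  then show ?thesis
    by (simp add: C_infinity_def)
qed

lemma network_map_coordinate:
  assumes "j \<in> {1..n}"
  shows "network_map N n \<sigma> (\<lambda>y. y j) x = compose {1..N} x (\<sigma> j)"
  using assms by (auto simp: network_map_def compose_def)

lemma robust_synchrony_space_iff_pullback:
  fixes P :: "nat set set"
  assumes "\<Union>P \<subseteq> {1..N}"
  shows "robust_synchrony_space N n \<sigma> (Syn N P :: (nat \<Rightarrow> 'v::real_normed_vector) set) \<longleftrightarrow>
         (\<forall>j\<in>{1..n}. \<forall>x\<in>Syn N P :: (nat \<Rightarrow> 'v) set. compose {1..N} x (\<sigma> j) \<in> Syn N P)"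
    (is "?robust \<longleftrightarrow> ?pullback")
proof
  assume robust: ?robust
  show ?pullback
  proof (intro ballI)
    fix j and x :: "nat \<Rightarrow> 'v"
    assume j: "j \<in> {1..n}" and x: "x \<in> Syn N P"
    have "network_map N n \<sigma> (\<lambda>y. y j) x \<in> Syn N P"
      using robust x C_infinity_coordinate[of n j]
      unfolding robust_synchrony_space_def by blast
    then show "compose {1..N} x (\<sigma> j) \<in> Syn N P"
      by (simp only: network_map_coordinate[OF j])
  qed
next
  assume pullback: ?pullback
  have "network_map N n \<sigma> f x \<in> Syn N P" if x: "x \<in> Syn N P" for f and x :: "nat \<Rightarrow> 'v"
  proof -
    have "network_map N n \<sigma> f x i\<^sub>1 = network_map N n \<sigma> f x i\<^sub>2"
      if "p \<in> P" "i\<^sub>1 \<in> p" "i\<^sub>2 \<in> p" for p i\<^sub>1 i\<^sub>2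
    proof -
      have nodes: "i\<^sub>1 \<in> {1..N}" "i\<^sub>2 \<in> {1..N}"
        using assms that by auto
      have "x (\<sigma> j i\<^sub>1) = x (\<sigma> j i\<^sub>2)" if j: "j \<in> {1..n}" for j
      proof -
        have "compose {1..N} x (\<sigma> j) i\<^sub>1 = compose {1..N} x (\<sigma> j) i\<^sub>2"
          using pullback j x \<open>p \<in> P\<close> \<open>i\<^sub>1 \<in> p\<close> \<open>i\<^sub>2 \<in> p\<close> unfolding Syn_def by blast
        then show ?thesis
          using nodes by (simp add: compose_eq)
      qed
      then have "(\<lambda>j\<in>{1..n}. x (\<sigma> j i\<^sub>1)) = (\<lambda>j\<in>{1..n}. x (\<sigma> j i\<^sub>2))"
        by (rule restrict_ext)
      then show ?thesis
        using nodes by (simp add: network_map_def)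
    qed
    moreover have "network_map N n \<sigma> f x \<in> tuples N"
      by (simp add: network_map_def tuples_def)
    ultimately show ?thesis
      unfolding Syn_def by blast
  qed
  then show ?robust
    unfolding robust_synchrony_space_def by blast
qed

lemma generated_semigroup_superset: "\<Sigma> \<subseteq> generated_semigroup N \<Sigma>"
  unfolding generated_semigroup_def by (rule hull_subset)

text \<open>The maps whose pullback preserves \<open>S\<close> are closed under composition, since pulling back along
  \<open>g \<circ> h\<close> means pulling back along \<open>g\<close> and then along \<open>h\<close>. On extensional functions this
  functoriality needs \<open>h\<close> to take values in \<open>{1..N}\<close>, so that condition is carried through the
  induction over the generated semigroup.\<close>

lemma pullback_generated_semigroup:
  fixes S :: "(nat \<Rightarrow> 'v) set"
  assumes maps: "\<Sigma> \<subseteq> {1..N} \<rightarrow> {1..N}"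
    and pullback: "\<And>g x. g \<in> \<Sigma> \<Longrightarrow> x \<in> S \<Longrightarrow> compose {1..N} x g \<in> S"
    and g: "g \<in> generated_semigroup N \<Sigma>"
    and x: "x \<in> S"
  shows "compose {1..N} x g \<in> S"
proof -
  let ?T = "{g \<in> {1..N} \<rightarrow> {1..N}. \<forall>x\<in>S. compose {1..N} x g \<in> S}"
  have "compose {1..N} g h \<in> ?T" if "g \<in> ?T" "h \<in> ?T" for g h
  proof -
    have "compose {1..N} x (compose {1..N} g h) = compose {1..N} (compose {1..N} x g) h" for x :: "nat \<Rightarrow> 'v"
      using that by (intro compose_assoc) auto
    then have "compose {1..N} x (compose {1..N} g h) \<in> S" if "x \<in> S" for x
      using that \<open>g \<in> ?T\<close> \<open>h \<in> ?T\<close> by simp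
    moreover have "compose {1..N} g h \<in> {1..N} \<rightarrow> {1..N}"
      using that by (simp add: Pi_iff compose_eq)
    ultimately show ?thesis
      by blast
  qed
  then have "generated_semigroup N \<Sigma> \<subseteq> ?T"
    unfolding generated_semigroup_def using maps pullback by (intro hull_minimal) auto
  then show ?thesis
    using g x by blast
qed

theorem lemma7p3:
  fixes N n n' :: nat
    and \<sigma> \<sigma>' :: "nat \<Rightarrow> nat \<Rightarrow> nat"
    and P :: "nat set set"
  assumes finite_dim: "\<exists>B :: 'v::real_normed_vector set. finite B \<and> span B = UNIV"
    and maps: "\<sigma> ` {1..n} \<subseteq> {1..N} \<rightarrow>\<^sub>E {1..N}"
    and distinct: "inj_on \<sigma> {1..n}"
    and enum: "bij_betw \<sigma>' {1..n'} (generated_semigroup N (\<sigma> ` {1..n}))"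
    and extends: "\<forall>j\<in>{1..n}. \<sigma>' j = \<sigma> j"
    and partition: "partition_on {1..N} P"
  shows "robust_synchrony_space N n \<sigma> (Syn N P :: (nat \<Rightarrow> 'v) set) \<longleftrightarrow>
         robust_synchrony_space N n' \<sigma>' (Syn N P :: (nat \<Rightarrow> 'v) set)"
proof -
  let ?preserves = "\<lambda>g. \<forall>x\<in>Syn N P :: (nat \<Rightarrow> 'v) set. compose {1..N} x g \<in> Syn N P"
  have classes: "\<Union>P \<subseteq> {1..N}"
    using partition by (simp add: partition_on_def)
  have image: "\<sigma>' ` {1..n'} = generated_semigroup N (\<sigma> ` {1..n})"
    using enum by (rule bij_betw_imp_surj_on)
  have funcset: "\<sigma> ` {1..n} \<subseteq> {1..N} \<rightarrow> {1..N}"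
    using maps by (auto simp: PiE_def)
  have "robust_synchrony_space N n \<sigma> (Syn N P :: (nat \<Rightarrow> 'v) set) \<longleftrightarrow>
        (\<forall>g\<in>\<sigma> ` {1..n}. ?preserves g)"
    by (simp add: robust_synchrony_space_iff_pullback[OF classes])
  also have "\<dots> \<longleftrightarrow> (\<forall>g\<in>generated_semigroup N (\<sigma> ` {1..n}). ?preserves g)"
  proof
    assume generators: "\<forall>g\<in>\<sigma> ` {1..n}. ?preserves g"
    show "\<forall>g\<in>generated_semigroup N (\<sigma> ` {1..n}). ?preserves g"
    proof (intro ballI)
      fix g and x :: "nat \<Rightarrow> 'v"
      assume g: "g \<in> generated_semigroup N (\<sigma> ` {1..n})" and x: "x \<in> Syn N P"
      show "compose {1..N} x g \<in> Syn N P"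
        by (rule pullback_generated_semigroup[OF funcset _ g x]) (use generators in blast)
    qed
  next
    assume "\<forall>g\<in>generated_semigroup N (\<sigma> ` {1..n}). ?preserves g"
    then show "\<forall>g\<in>\<sigma> ` {1..n}. ?preserves g"
      using generated_semigroup_superset by (meson subsetD)
  qed
  also have "\<dots> \<longleftrightarrow> robust_synchrony_space N n' \<sigma>' (Syn N P :: (nat \<Rightarrow> 'v) set)"
    unfolding image[symmetric] by (simp add: robust_synchrony_space_iff_pullback[OF classes])
  finally show ?thesis .
qed

end
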